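(* A group $G$ can be equipped with a compatible weak order distinct from the equality relation if and only if $G$ admits a totally orderable quotient by some proper normal subgroup (that is, there is a normal subgroup $H\neq G$ such that $G/H$ can be equipped with a compatible total order). If $G$ is abelian, these conditions amount to the fact that the subgroup $T(G)$ of torsion elements of $G$ is a proper subgroup of $G$.
   Context: Groups are not assumed abelian unless stated. An order on a group is compatible if it is preserved by all left and right translations. An order is a weak order if it does not embed $1\oplus 2$ (the disjoint union of a one-element poset and a 2-element chain, with no comparabilities between them); equivalently, the relation "$x$ is incomparable to $y$ or $x=y$" is an equivalence relation. *)

theory Defs
  imports "HOL-Algebra.Coset"
begin

text \<open>
  An order is a reflexive partial order, given as a relation contained in the square of its
  ground set. A map that preserves and reflects the order is automatically injective on a poset.
\<close>

definition poset_embeds :: "'a set \<Rightarrow> 'a rel \<Rightarrow> 'b set \<Rightarrow> 'b rel \<Rightarrow> bool" where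
  "poset_embeds A r B s \<longleftrightarrow>
     (\<exists>f. f ` A \<subseteq> B \<and> (\<forall>x\<in>A. \<forall>y\<in>A. (x, y) \<in> r \<longleftrightarrow> (f x, f y) \<in> s))"

text \<open>The poset \<open>1 \<oplus> 2\<close>: the isolated point is 0 and the chain is \<open>1 < 2\<close>.\<close>

definition one_plus_two_carrier :: "nat set" where
  "one_plus_two_carrier = {0, 1, 2}"

definition one_plus_two :: "nat rel" where
  "one_plus_two = {(0, 0), (1, 1), (2, 2), (1, 2)}"

definition weak_order_on :: "'a set \<Rightarrow> 'a rel \<Rightarrow> bool" where
  "weak_order_on A r \<longleftrightarrow>
     partial_order_on A r \<and> \<not> poset_embeds one_plus_two_carrier one_plus_two A r"

definition compatible_rel :: "('a, 'b) monoid_scheme \<Rightarrow> 'a rel \<Rightarrow> bool" where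
  "compatible_rel G r \<longleftrightarrow>
     (\<forall>x\<in>carrier G. \<forall>y\<in>carrier G. \<forall>z\<in>carrier G. (x, y) \<in> r \<longrightarrow>
        (z \<otimes>\<^bsub>G\<^esub> x, z \<otimes>\<^bsub>G\<^esub> y) \<in> r \<and> (x \<otimes>\<^bsub>G\<^esub> z, y \<otimes>\<^bsub>G\<^esub> z) \<in> r)"

definition totally_orderable :: "('a, 'b) monoid_scheme \<Rightarrow> bool" where
  "totally_orderable G \<longleftrightarrow> (\<exists>r. linear_order_on (carrier G) r \<and> compatible_rel G r)"

definition torsion :: "('a, 'b) monoid_scheme \<Rightarrow> 'a set" where
  "torsion G = {x \<in> carrier G. \<exists>n::nat. n > 0 \<and> x [^]\<^bsub>G\<^esub> n = \<one>\<^bsub>G\<^esub>}"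

lemma weak_order_on_iff:
  "weak_order_on A r \<longleftrightarrow> partial_order_on A r \<and>
     \<not> (\<exists>a\<in>A. \<exists>b\<in>A. \<exists>c\<in>A. b \<noteq> c \<and> (b, c) \<in> r \<and>
          (a, b) \<notin> r \<and> (b, a) \<notin> r \<and> (a, c) \<notin> r \<and> (c, a) \<notin> r)"
proof -
  have "poset_embeds one_plus_two_carrier one_plus_two A r \<longleftrightarrow>
     (\<exists>a\<in>A. \<exists>b\<in>A. \<exists>c\<in>A. b \<noteq> c \<and> (b, c) \<in> r \<and>
          (a, b) \<notin> r \<and> (b, a) \<notin> r \<and> (a, c) \<notin> r \<and> (c, a) \<notin> r)" (is "?L \<longleftrightarrow> ?R")
    if po: "partial_order_on A r"
  proof
    assume ?L
    then obtain f where f: "f ` {0, 1, 2} \<subseteq> A"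
      "\<forall>x\<in>{0, 1, 2}. \<forall>y\<in>{0, 1, 2}. (x, y) \<in> one_plus_two \<longleftrightarrow> (f x, f y) \<in> r"
      unfolding poset_embeds_def one_plus_two_carrier_def by blast
    have "f 0 \<in> A" "f 1 \<in> A" "f 2 \<in> A" "(f 1, f 2) \<in> r" "(f 2, f 1) \<notin> r" "(f 1, f 1) \<in> r"
      "(f 0, f 1) \<notin> r" "(f 1, f 0) \<notin> r" "(f 0, f 2) \<notin> r" "(f 2, f 0) \<notin> r"
      using f by (auto simp: one_plus_two_def)
    then show ?R by metis
  next
    assume ?R
    then obtain a b c where *: "a \<in> A" "b \<in> A" "c \<in> A" "b \<noteq> c" "(b, c) \<in> r"
      "(a, b) \<notin> r" "(b, a) \<notin> r" "(a, c) \<notin> r" "(c, a) \<notin> r" by blast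
    have "(a, a) \<in> r" "(b, b) \<in> r" "(c, c) \<in> r" "(c, b) \<notin> r"
      using * partial_order_onD[OF po] by (auto dest: refl_onD antisymD)
    with * show ?L
      unfolding poset_embeds_def one_plus_two_carrier_def one_plus_two_def
      by (intro exI[of _ "\<lambda>n. if n = 0 then a else if n = 1 then b else c"]) auto
  qed
  then show ?thesis unfolding weak_order_on_def by blast
qed

lemma weak_order_on_iff_equiv:
  "weak_order_on A r \<longleftrightarrow> partial_order_on A r \<and>
     equiv A {(x, y) \<in> A \<times> A. x = y \<or> ((x, y) \<notin> r \<and> (y, x) \<notin> r)}"
proof -
  have "(\<exists>a\<in>A. \<exists>b\<in>A. \<exists>c\<in>A. b \<noteq> c \<and> (b, c) \<in> r \<and>
          (a, b) \<notin> r \<and> (b, a) \<notin> r \<and> (a, c) \<notin> r \<and> (c, a) \<notin> r) \<longleftrightarrow>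
        \<not> trans {(x, y) \<in> A \<times> A. x = y \<or> ((x, y) \<notin> r \<and> (y, x) \<notin> r)}" (is "?L \<longleftrightarrow> ?R")
    if po: "partial_order_on A r"
  proof
    assume ?L
    then obtain a b c where *: "a \<in> A" "b \<in> A" "c \<in> A" "b \<noteq> c" "(b, c) \<in> r"
      "(a, b) \<notin> r" "(b, a) \<notin> r" "(a, c) \<notin> r" "(c, a) \<notin> r" by blast
    show ?R
    proof
      assume "trans {(x, y) \<in> A \<times> A. x = y \<or> ((x, y) \<notin> r \<and> (y, x) \<notin> r)}"
      from transD[OF this, of b a c] * show False by simp
    qed
  next
    assume ?R
    then obtain x y z where *: "x \<in> A" "y \<in> A" "z \<in> A"
      "x = y \<or> ((x, y) \<notin> r \<and> (y, x) \<notin> r)" "y = z \<or> ((y, z) \<notin> r \<and> (z, y) \<notin> r)"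
      "x \<noteq> z" "(x, z) \<in> r \<or> (z, x) \<in> r"
      unfolding trans_def by blast
    then show ?L by metis
  qed
  moreover have "equiv A {(x, y) \<in> A \<times> A. x = y \<or> ((x, y) \<notin> r \<and> (y, x) \<notin> r)} \<longleftrightarrow>
      trans {(x, y) \<in> A \<times> A. x = y \<or> ((x, y) \<notin> r \<and> (y, x) \<notin> r)}"
    unfolding equiv_def by (auto simp: refl_on_def sym_def)
  ultimately show ?thesis unfolding weak_order_on_iff by blast
qed

end

theory Submission
  imports Defs
begin

text \<open>
  Everything passes through compatible total preorders \<open>Q\<close> on \<open>G\<close> that leave at least one pair
  of elements strictly ordered. Such a preorder is the same thing as a nontrivial compatible weak
  order: comparing strictly in one is comparing strictly in the other, and incomparability for the
  weak order is equivalence for the preorder. It is also the same thing as a total order on a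
  nontrivial quotient: the elements equivalent to \<open>\<one>\<close> form a proper normal subgroup
  \<open>H\<close>, equivalence classes are cosets of \<open>H\<close>, and \<open>Q\<close> is the pullback
  of a total order on \<open>G Mod H\<close>. Hence the first equivalence.

  If \<open>x\<close> lies strictly above \<open>\<one>\<close>, its powers increase and never return
  to \<open>\<one>\<close>, so \<open>G\<close> is not a torsion group. Conversely, in an abelian group,
  the powers \<open>x\<^sup>n\<close> with \<open>n \<ge> 0\<close> of an element of infinite order form a
  submonoid avoiding \<open>x\<inverse>\<close>. Zorn's lemma enlarges it to a submonoid \<open>P\<close>
  maximal among those that contain \<open>x\<close> and avoid \<open>x\<inverse>\<close>, and a computation with exponents shows that
  \<open>P\<close> contains each element or its inverse; thus \<open>P\<close> is the set of elements
  \<open>\<ge> \<one>\<close> of a total preorder. Taking the maximal cone relative to one element, and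
  accepting a preorder, avoids both the quotient by the torsion subgroup and Levi's
  theorem that torsion-free abelian groups are orderable.
\<close>

section \<open>Compatible total preorders\<close>

text \<open>
  Given totality, the last clause says that some pair is strictly ordered. It corresponds both to
  a weak order being different from equality and to a subgroup being proper.
\<close>

definition proper_preorder :: "('a, 'b) monoid_scheme \<Rightarrow> 'a rel \<Rightarrow> bool" where
  "proper_preorder G Q \<longleftrightarrow>
     Q \<subseteq> carrier G \<times> carrier G \<and> trans Q \<and> compatible_rel G Q \<and>
     (\<forall>x\<in>carrier G. \<forall>y\<in>carrier G. (x, y) \<in> Q \<or> (y, x) \<in> Q) \<and>
     Q \<noteq> carrier G \<times> carrier G"

lemma compatible_relD:
  assumes "compatible_rel G r" "(x, y) \<in> r" "x \<in> carrier G" "y \<in> carrier G" "z \<in> carrier G"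
  shows "(z \<otimes>\<^bsub>G\<^esub> x, z \<otimes>\<^bsub>G\<^esub> y) \<in> r" "(x \<otimes>\<^bsub>G\<^esub> z, y \<otimes>\<^bsub>G\<^esub> z) \<in> r"
  using assms unfolding compatible_rel_def by blast+

lemma (in group) compatible_rel_left_iff:
  assumes "compatible_rel G r" and c: "x \<in> carrier G" "y \<in> carrier G" "z \<in> carrier G"
  shows "(z \<otimes> x, z \<otimes> y) \<in> r \<longleftrightarrow> (x, y) \<in> r"
proof
  assume "(z \<otimes> x, z \<otimes> y) \<in> r"
  from compatible_relD(1)[OF assms(1) this, of "inv z"]
  show "(x, y) \<in> r" using c by (simp add: m_assoc[symmetric])
qed (use compatible_relD[OF assms(1)] c in auto)

lemma (in group) compatible_rel_right_iff:
  assumes "compatible_rel G r" and c: "x \<in> carrier G" "y \<in> carrier G" "z \<in> carrier G"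
  shows "(x \<otimes> z, y \<otimes> z) \<in> r \<longleftrightarrow> (x, y) \<in> r"
proof
  assume "(x \<otimes> z, y \<otimes> z) \<in> r"
  from compatible_relD(2)[OF assms(1) this, of "inv z"]
  show "(x, y) \<in> r" using c by (simp add: m_assoc)
qed (use compatible_relD[OF assms(1)] c in auto)

section \<open>Weak orders and preorders\<close>

text \<open>
  A weak order becomes a total preorder by declaring incomparable elements equivalent; the
  absence of \<open>1 \<oplus> 2\<close> is exactly what transitivity needs.
\<close>

lemma (in group) weak_order_imp_proper_preorder:
  assumes w: "weak_order_on (carrier G) r" and c: "compatible_rel G r"
    and ne: "r \<noteq> Id_on (carrier G)"
  shows "proper_preorder G {(x, y) \<in> carrier G \<times> carrier G. x = y \<or> (y, x) \<notin> r}"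
    (is "proper_preorder G ?Q")
proof -
  have po: "partial_order_on (carrier G) r"
    and no: "\<And>a b c. a \<in> carrier G \<Longrightarrow> b \<in> carrier G \<Longrightarrow> c \<in> carrier G \<Longrightarrow> b \<noteq> c \<Longrightarrow>
      (b, c) \<in> r \<Longrightarrow> (a, b) \<in> r \<or> (b, a) \<in> r \<or> (a, c) \<in> r \<or> (c, a) \<in> r"
    using w unfolding weak_order_on_iff by blast+
  from po have r: "refl_on (carrier G) r" "trans r" "antisym r" "r \<subseteq> carrier G \<times> carrier G"
    by (auto simp: partial_order_on_def preorder_on_def)
  have "trans ?Q"
  proof (rule transI)
    fix x y z assume "(x, y) \<in> ?Q" "(y, z) \<in> ?Q"
    then show "(x, z) \<in> ?Q"
      using no[of y z x] transD[OF r(2)] antisymD[OF r(3)] by auto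
  qed
  moreover have "compatible_rel G ?Q"
    using c unfolding compatible_rel_def
    by (auto simp: compatible_rel_left_iff[OF c] compatible_rel_right_iff[OF c])
  moreover have "?Q \<noteq> carrier G \<times> carrier G"
  proof
    assume "?Q = carrier G \<times> carrier G"
    then have "r = Id_on (carrier G)"
      using r(1,4) by (auto simp: refl_on_def Id_on_def)
    with ne show False ..
  qed
  moreover have "(x, y) \<in> ?Q \<or> (y, x) \<in> ?Q" if "x \<in> carrier G" "y \<in> carrier G" for x y
    using that antisymD[OF r(3)] by auto
  ultimately show ?thesis
    unfolding proper_preorder_def by blast
qed

text \<open>
  Conversely, keep the strict part of the preorder and make equivalent elements incomparable.
\<close>

lemma (in group) proper_preorder_imp_weak_order:
  assumes Q: "proper_preorder G Q"
  shows "\<exists>r. weak_order_on (carrier G) r \<and> compatible_rel G r \<and> r \<noteq> Id_on (carrier G)"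
proof -
  define r where "r = {(x, y) \<in> carrier G \<times> carrier G. x = y \<or> (y, x) \<notin> Q}"
  have sub: "Q \<subseteq> carrier G \<times> carrier G" and tr: "trans Q" and co: "compatible_rel G Q"
    and tot: "\<And>x y. x \<in> carrier G \<Longrightarrow> y \<in> carrier G \<Longrightarrow> (x, y) \<in> Q \<or> (y, x) \<in> Q"
    and ne: "Q \<noteq> carrier G \<times> carrier G"
    using Q unfolding proper_preorder_def by blast+
  have "trans r"
  proof (rule transI)
    fix x y z assume "(x, y) \<in> r" "(y, z) \<in> r"
    then show "(x, z) \<in> r"
      unfolding r_def using tot[of x y] transD[OF tr, of z x y] by auto
  qed
  then have "partial_order_on (carrier G) r"
    using tot unfolding partial_order_on_def preorder_on_def refl_on_def antisym_def r_def by auto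
  moreover have "\<not> (\<exists>a\<in>carrier G. \<exists>b\<in>carrier G. \<exists>c\<in>carrier G. b \<noteq> c \<and> (b, c) \<in> r \<and>
      (a, b) \<notin> r \<and> (b, a) \<notin> r \<and> (a, c) \<notin> r \<and> (c, a) \<notin> r)"
    using tr unfolding r_def trans_def by blast
  moreover have "compatible_rel G r"
    unfolding compatible_rel_def r_def
    by (auto simp: compatible_rel_left_iff[OF co] compatible_rel_right_iff[OF co])
  moreover have "r \<noteq> Id_on (carrier G)"
  proof -
    obtain x y where xy: "x \<in> carrier G" "y \<in> carrier G" "(x, y) \<notin> Q"
      using sub ne by auto
    then have "(y, x) \<in> r" "y \<noteq> x" using tot[of x x] unfolding r_def by auto
    then show ?thesis by auto
  qed
  ultimately show ?thesis unfolding weak_order_on_iff by blast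
qed

section \<open>Ordered quotients and preorders\<close>

text \<open>
  Translating by elements shows that \<open>x\<close> and \<open>y\<close> are equivalent exactly when
  \<open>y \<otimes> inv x\<close> is equivalent to \<open>\<one>\<close>. So the classes are the
  cosets of the subgroup of elements equivalent to the identity, and the preorder descends to a
  total order on the quotient by it.
\<close>

lemma (in group) proper_preorder_imp_orderable_quotient:
  assumes Q: "proper_preorder G Q"
  shows "\<exists>H. H \<lhd> G \<and> H \<noteq> carrier G \<and> totally_orderable (G Mod H)"
proof -
  have sub: "Q \<subseteq> carrier G \<times> carrier G" and tr: "trans Q" and co: "compatible_rel G Q"
    and tot: "\<And>x y. x \<in> carrier G \<Longrightarrow> y \<in> carrier G \<Longrightarrow> (x, y) \<in> Q \<or> (y, x) \<in> Q"
    and ne: "Q \<noteq> carrier G \<times> carrier G"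
    using Q unfolding proper_preorder_def by blast+
  note L = compatible_rel_left_iff[OF co] and R = compatible_rel_right_iff[OF co]
  note T = transD[OF tr]
  define H where "H = {x \<in> carrier G. (\<one>, x) \<in> Q \<and> (x, \<one>) \<in> Q}"
  have H_iff: "y \<otimes> inv x \<in> H \<longleftrightarrow> (x, y) \<in> Q \<and> (y, x) \<in> Q"
    if "x \<in> carrier G" "y \<in> carrier G" for x y
    using R[of \<one> "y \<otimes> inv x" x] R[of "y \<otimes> inv x" \<one> x] that
    unfolding H_def by (simp add: m_assoc)
  have "subgroup H G"
  proof
    show "\<one> \<in> H" using tot[of \<one> \<one>] by (simp add: H_def)
  next
    fix x y assume xy: "x \<in> H" "y \<in> H"
    then have c: "x \<in> carrier G" "y \<in> carrier G" by (auto simp: H_def)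
    have "(x, x \<otimes> y) \<in> Q" "(x \<otimes> y, x) \<in> Q"
      using L[of \<one> y x] L[of y \<one> x] xy c by (auto simp: H_def)
    then show "x \<otimes> y \<in> H"
      using xy c T[of \<one> x "x \<otimes> y"] T[of "x \<otimes> y" x \<one>] by (auto simp: H_def)
  next
    fix x assume x: "x \<in> H"
    then have "x \<in> carrier G" by (auto simp: H_def)
    then show "inv x \<in> H"
      using x L[of \<one> "inv x" x] L[of "inv x" \<one> x] by (auto simp: H_def)
  qed (auto simp: H_def)
  moreover have "x \<otimes> h \<otimes> inv x \<in> H" if "x \<in> carrier G" "h \<in> H" for x h
  proof -
    have h: "h \<in> carrier G" using that by (simp add: H_def)
    show ?thesis
      using H_iff[of x "x \<otimes> h"] L[of \<one> h x] L[of h \<one> x] that h by (simp add: H_def)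
  qed
  ultimately have N: "H \<lhd> G"
    using normal_inv_iff by blast
  interpret N: normal H G by (rule N)
  have coset_iff: "H #> x = H #> y \<longleftrightarrow> (x, y) \<in> Q \<and> (y, x) \<in> Q"
    if "x \<in> carrier G" "y \<in> carrier G" for x y
  proof -
    have "H #> x = H #> y \<longleftrightarrow> y \<in> H #> x"
      using repr_independence[of y H x] repr_independenceD[of H y x] that N.subgroup_axioms by blast
    also have "\<dots> \<longleftrightarrow> y \<otimes> inv x \<in> H"
      using that is_group by (intro N.rcos_module)
    finally show ?thesis using H_iff[OF that] by simp
  qed
  define s where "s = {(H #> x, H #> y) | x y. (x, y) \<in> Q}"
  have s_iff: "(H #> x, H #> y) \<in> s \<longleftrightarrow> (x, y) \<in> Q"
    if xy: "x \<in> carrier G" "y \<in> carrier G" for x y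
  proof
    assume "(H #> x, H #> y) \<in> s"
    then obtain x' y' where *: "H #> x = H #> x'" "H #> y = H #> y'" "(x', y') \<in> Q"
      unfolding s_def by blast
    then have "(x, x') \<in> Q" "(y', y) \<in> Q" using coset_iff xy sub by blast+
    with * show "(x, y) \<in> Q" using T by blast
  qed (auto simp: s_def)
  have carr: "carrier (G Mod H) = (\<lambda>x. H #> x) ` carrier G"
    by (rule carrier_FactGroup)
  have "linear_order_on (carrier (G Mod H)) s"
    unfolding linear_order_on_def partial_order_on_def preorder_on_def
  proof (intro conjI)
    show "s \<subseteq> carrier (G Mod H) \<times> carrier (G Mod H)"
      using sub unfolding s_def carr by auto
    show "refl_on (carrier (G Mod H)) s"
      using tot unfolding refl_on_def carr by (auto simp: s_iff)
    show "total_on (carrier (G Mod H)) s"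
      using tot unfolding total_on_def carr by (auto simp: s_iff)
    show "trans s"
    proof (rule transI)
      fix a b c assume ab: "(a, b) \<in> s" and bc: "(b, c) \<in> s"
      obtain x y where x: "a = H #> x" "b = H #> y" "(x, y) \<in> Q"
        using ab unfolding s_def by blast
      obtain y' z where z: "c = H #> z" "(y', z) \<in> Q"
        using bc unfolding s_def by blast
      have cs: "x \<in> carrier G" "y \<in> carrier G" "z \<in> carrier G" using x z sub by auto
      then show "(a, c) \<in> s" using bc x z s_iff T[of x y z] by auto
    qed
    show "antisym s"
    proof (rule antisymI)
      fix a b assume ab: "(a, b) \<in> s" and ba: "(b, a) \<in> s"
      obtain x y where x: "a = H #> x" "b = H #> y" "(x, y) \<in> Q"
        using ab unfolding s_def by blast
      then have cs: "x \<in> carrier G" "y \<in> carrier G" using sub by auto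
      then show "a = b" using ba x s_iff coset_iff by auto
    qed
  qed
  moreover have "compatible_rel (G Mod H) s"
    unfolding compatible_rel_def carr by (auto simp: N.rcos_sum s_iff L R)
  moreover have "H \<noteq> carrier G"
  proof
    assume H: "H = carrier G"
    have "(x, y) \<in> Q" if "x \<in> carrier G" "y \<in> carrier G" for x y
      using T[of x \<one> y] that H unfolding H_def by blast
    then show False using ne sub by auto
  qed
  ultimately show ?thesis using N unfolding totally_orderable_def by blast
qed

text \<open>In the other direction the preorder compares cosets.\<close>

lemma (in group) orderable_quotient_imp_proper_preorder:
  assumes N: "H \<lhd> G" and ne: "H \<noteq> carrier G" and ord: "totally_orderable (G Mod H)"
  shows "\<exists>Q. proper_preorder G Q"
proof -
  interpret N: normal H G by (rule N)
  obtain s where s: "linear_order_on (carrier (G Mod H)) s" and co: "compatible_rel (G Mod H) s"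
    using ord unfolding totally_orderable_def by blast
  have s': "refl_on (carrier (G Mod H)) s" "trans s" "antisym s" "total_on (carrier (G Mod H)) s"
    using s by (auto simp: linear_order_on_def partial_order_on_def preorder_on_def)
  have carr: "carrier (G Mod H) = (\<lambda>x. H #> x) ` carrier G"
    by (rule carrier_FactGroup)
  define Q where "Q = {(x, y) \<in> carrier G \<times> carrier G. (H #> x, H #> y) \<in> s}"
  have "trans Q"
    using s'(2) unfolding Q_def trans_def by blast
  moreover have "compatible_rel G Q"
    unfolding compatible_rel_def Q_def
  proof (intro ballI impI)
    fix x y z
    assume c: "x \<in> carrier G" "y \<in> carrier G" "z \<in> carrier G"
      and "(x, y) \<in> {(x, y) \<in> carrier G \<times> carrier G. (H #> x, H #> y) \<in> s}"
    then have "(H #> x, H #> y) \<in> s" by simp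
    from compatible_relD[OF co this, of "H #> z"] c
    show "(z \<otimes> x, z \<otimes> y) \<in> {(x, y) \<in> carrier G \<times> carrier G. (H #> x, H #> y) \<in> s} \<and>
      (x \<otimes> z, y \<otimes> z) \<in> {(x, y) \<in> carrier G \<times> carrier G. (H #> x, H #> y) \<in> s}"
      by (simp add: carr N.rcos_sum)
  qed
  moreover have "(x, y) \<in> Q \<or> (y, x) \<in> Q" if "x \<in> carrier G" "y \<in> carrier G" for x y
    using s'(1,4) that unfolding Q_def carr refl_on_def total_on_def by (cases "H #> x = H #> y") auto
  moreover have "Q \<noteq> carrier G \<times> carrier G"
  proof
    assume Q: "Q = carrier G \<times> carrier G"
    obtain x where x: "x \<in> carrier G" "x \<notin> H" using ne N.subset by blast
    then have "(x, \<one>) \<in> Q" "(\<one>, x) \<in> Q" using Q by auto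
    then have "H #> x = H #> \<one>" using antisymD[OF s'(3)] unfolding Q_def by blast
    then have "x \<in> H" using rcos_self[OF x(1) N.subgroup_axioms] N.subset by (simp add: coset_mult_one)
    with x show False by simp
  qed
  ultimately have "proper_preorder G Q"
    unfolding proper_preorder_def by (auto simp: Q_def)
  then show ?thesis by blast
qed

section \<open>Torsion\<close>

text \<open>
  Powers of an element strictly above the identity stay at or above that element, hence never
  return to the identity.
\<close>

lemma (in group) proper_preorder_imp_not_torsion:
  assumes Q: "proper_preorder G Q"
  shows "torsion G \<noteq> carrier G"
proof -
  have sub: "Q \<subseteq> carrier G \<times> carrier G" and tr: "trans Q" and co: "compatible_rel G Q"
    and tot: "\<And>x y. x \<in> carrier G \<Longrightarrow> y \<in> carrier G \<Longrightarrow> (x, y) \<in> Q \<or> (y, x) \<in> Q"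
    and ne: "Q \<noteq> carrier G \<times> carrier G"
    using Q unfolding proper_preorder_def by blast+
  obtain a b where ab: "a \<in> carrier G" "b \<in> carrier G" "(a, b) \<notin> Q"
    using sub ne by auto
  define x where "x = inv b \<otimes> a"
  have x: "x \<in> carrier G" using ab by (simp add: x_def)
  have bx: "b \<otimes> x = a" using ab by (simp add: x_def m_assoc[symmetric])
  have "(x, \<one>) \<notin> Q"
    using compatible_rel_left_iff[OF co, of x \<one> b] ab x bx by simp
  with tot[of x \<one>] x have "(\<one>, x) \<in> Q" by auto
  have "(x, x [^] Suc n) \<in> Q" for n
  proof (induction n)
    case 0
    then show ?case using tot[of x x] x by simp
  next
    case (Suc n)
    have "(\<one> \<otimes> x [^] Suc n, x \<otimes> x [^] Suc n) \<in> Q"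
      using compatible_relD(2)[OF co \<open>(\<one>, x) \<in> Q\<close>] x by blast
    then have "(x [^] Suc n, x [^] Suc (Suc n)) \<in> Q"
      using x nat_pow_Suc2[of x "Suc n"] by simp
    then show ?case using Suc transD[OF tr] by blast
  qed
  then have "x [^] n \<noteq> \<one>" if "n > 0" for n :: nat
    using that \<open>(x, \<one>) \<notin> Q\<close> by (metis gr0_implies_Suc)
  then have "x \<notin> torsion G" by (auto simp: torsion_def)
  with x show ?thesis by blast
qed

lemma (in comm_group) subgroup_torsion: "subgroup (torsion G) G"
proof
  show "torsion G \<subseteq> carrier G" by (auto simp: torsion_def)
  show "\<one> \<in> torsion G" by (auto simp: torsion_def intro: exI[of _ 1])
  show "x \<otimes> y \<in> torsion G" if xy: "x \<in> torsion G" "y \<in> torsion G" for x y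
  proof -
    obtain m n :: nat where c: "x \<in> carrier G" "y \<in> carrier G" "m > 0" "n > 0"
      and p: "x [^] m = \<one>" "y [^] n = \<one>"
      using xy by (auto simp: torsion_def)
    have "(x \<otimes> y) [^] (m * n) = (x [^] m) [^] n \<otimes> (y [^] n) [^] m"
      using c by (simp add: nat_pow_distrib nat_pow_pow mult.commute)
    also have "\<dots> = \<one>" by (simp add: p)
    finally show ?thesis using c by (auto simp: torsion_def intro!: exI[of _ "m * n"])
  qed
  show "inv x \<in> torsion G" if "x \<in> torsion G" for x
    using that by (auto simp: torsion_def nat_pow_inv intro!: exI)
qed

lemma (in comm_monoid) submonoid_adjoin:
  assumes P: "submonoid P G" and a: "a \<in> carrier G"
  shows "submonoid {p \<otimes> a [^] (n::nat) | p n. p \<in> P} G"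
proof
  show "{p \<otimes> a [^] (n::nat) | p n. p \<in> P} \<subseteq> carrier G"
    using submonoid.subset[OF P] a by auto
  show "\<one> \<in> {p \<otimes> a [^] (n::nat) | p n. p \<in> P}"
    using submonoid.one_closed[OF P] by (auto intro!: exI[of _ \<one>] exI[of _ "0::nat"])
next
  fix x y assume "x \<in> {p \<otimes> a [^] (n::nat) | p n. p \<in> P}" "y \<in> {p \<otimes> a [^] (n::nat) | p n. p \<in> P}"
  then obtain p q and m n :: nat
    where e: "x = p \<otimes> a [^] m" "y = q \<otimes> a [^] n" and pq: "p \<in> P" "q \<in> P" by blast
  have "p \<in> carrier G" "q \<in> carrier G" using pq submonoid.subset[OF P] by auto
  then have "x \<otimes> y = (p \<otimes> q) \<otimes> a [^] (m + n)"
    using a by (simp add: e nat_pow_mult[symmetric] m_ac)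
  then show "x \<otimes> y \<in> {p \<otimes> a [^] (n::nat) | p n. p \<in> P}"
    using submonoid.m_closed[OF P pq] by blast
qed

lemma (in monoid) submonoid_nat_pow_closed:
  assumes "submonoid P G" "p \<in> P"
  shows "p [^] (n::nat) \<in> P"
  using assms by (induction n) (auto intro: submonoid.one_closed submonoid.m_closed)

text \<open>
  If neither \<open>a\<close> nor its inverse could be adjoined without reaching \<open>inv x\<close>, then
  \<open>inv x\<close> would equal both \<open>p \<otimes> a [^] m\<close> and \<open>q \<otimes> inv a [^] n\<close>
  with \<open>p\<close> and \<open>q\<close> in the submonoid. The \<open>n\<close>-th power of the first times
  the \<open>m\<close>-th power of the second cancels \<open>a\<close> and puts a negative power of
  \<open>x\<close> in the submonoid; multiplying by a power of \<open>x\<close> brings it back to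
  \<open>inv x\<close>.
\<close>

lemma (in comm_group) submonoid_avoiding_inverse_adjoin:
  assumes P: "submonoid P G" and x: "x \<in> P" and nx: "inv x \<notin> P" and a: "a \<in> carrier G"
    and p: "p \<in> P" "inv x = p \<otimes> a [^] (m::nat)"
    and q: "q \<in> P" "inv x = q \<otimes> inv a [^] (n::nat)"
  shows False
proof -
  have xc: "x \<in> carrier G" and pc: "p \<in> carrier G" and qc: "q \<in> carrier G"
    using x p q submonoid.subset[OF P] by auto
  \<comment> \<open>This makes \<open>n + m - 1\<close> below a true predecessor of \<open>n + m\<close>.\<close>
  have "m > 0" using p pc nx by (cases m) auto
  have "inv x [^] (n + m) = inv x [^] n \<otimes> inv x [^] m"
    using xc by (simp add: nat_pow_mult)
  also have "\<dots> = (p \<otimes> a [^] m) [^] n \<otimes> (q \<otimes> inv a [^] n) [^] m"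
    using p(2) q(2) by simp
  also have "\<dots> = p [^] n \<otimes> (a [^] (m * n) \<otimes> inv a [^] (m * n)) \<otimes> q [^] m"
    using a pc qc by (simp add: nat_pow_distrib nat_pow_pow m_ac mult.commute)
  also have "\<dots> = p [^] n \<otimes> q [^] m"
    using a pc qc by (simp add: nat_pow_inv)
  finally have "inv x [^] (n + m) \<in> P"
    using submonoid_nat_pow_closed[OF P] submonoid.m_closed[OF P] p q by simp
  moreover have "x [^] (n + m - 1) \<in> P"
    using submonoid_nat_pow_closed[OF P x] .
  moreover have "inv x [^] (n + m) \<otimes> x [^] (n + m - 1) = inv x"
  proof -
    obtain k where k: "n + m = Suc k" using \<open>m > 0\<close> by (cases "n + m") auto
    have "inv x [^] Suc k \<otimes> x [^] k = inv x \<otimes> (inv x [^] k \<otimes> x [^] k)"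
      using xc by (simp add: m_ac)
    also have "\<dots> = inv x" using xc by (simp add: nat_pow_inv)
    finally show ?thesis by (simp add: k)
  qed
  ultimately show False using submonoid.m_closed[OF P] nx by metis
qed

text \<open>
  The witness is maximal among the submonoids that contain \<open>x\<close> and avoid
  \<open>inv x\<close>; infinite order of \<open>x\<close> is what makes this family nonempty.
\<close>

lemma (in comm_group) exists_total_submonoid:
  assumes x: "x \<in> carrier G" "x \<notin> torsion G"
  obtains P where "submonoid P G" "inv x \<notin> P" "\<And>a. a \<in> carrier G \<Longrightarrow> a \<in> P \<or> inv a \<in> P"
proof -
  define \<A> where "\<A> = {P. submonoid P G \<and> x \<in> P \<and> inv x \<notin> P}"
  have "range (\<lambda>n::nat. x [^] n) \<in> \<A>"
  proof -
    have "submonoid (range (\<lambda>n::nat. x [^] n)) G"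
    proof
      show "range (\<lambda>n::nat. x [^] n) \<subseteq> carrier G" using x by auto
      show "\<one> \<in> range (\<lambda>n::nat. x [^] n)" by (auto intro: range_eqI[of _ _ 0])
    qed (use x in \<open>auto simp: nat_pow_mult\<close>)
    moreover have "x \<in> range (\<lambda>n::nat. x [^] n)"
      using x by (auto intro: range_eqI[of _ _ 1])
    moreover have "inv x \<noteq> x [^] n" for n :: nat
    proof
      assume "inv x = x [^] n"
      then have "x [^] Suc n = \<one>" using x by (metis l_inv nat_pow_Suc)
      then show False using x by (auto simp: torsion_def)
    qed
    ultimately show ?thesis by (auto simp: \<A>_def)
  qed
  moreover have "\<Union>C \<in> \<A>" if ne: "C \<noteq> {}" and ch: "subset.chain \<A> C" for C
  proof -
    have CA: "\<And>P. P \<in> C \<Longrightarrow> submonoid P G \<and> x \<in> P \<and> inv x \<notin> P"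
      and lin: "\<And>P P'. P \<in> C \<Longrightarrow> P' \<in> C \<Longrightarrow> P \<subseteq> P' \<or> P' \<subseteq> P"
      using ch unfolding subset_chain_def \<A>_def by blast+
    have "submonoid (\<Union>C) G"
    proof
      show "\<Union>C \<subseteq> carrier G" using CA submonoid.subset by blast
      show "\<one> \<in> \<Union>C" using CA ne submonoid.one_closed by blast
    next
      fix a b assume "a \<in> \<Union>C" "b \<in> \<Union>C"
      then obtain P where P: "P \<in> C" "a \<in> P" "b \<in> P" using lin by blast
      then have "a \<otimes> b \<in> P" using CA submonoid.m_closed[of P G a b] by simp
      then show "a \<otimes> b \<in> \<Union>C" using P(1) by blast
    qed
    then show ?thesis using CA ne by (auto simp: \<A>_def)
  qed
  ultimately obtain P where PA: "P \<in> \<A>" and max: "\<And>X. X \<in> \<A> \<Longrightarrow> P \<subseteq> X \<Longrightarrow> X = P"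
    using subset_Zorn_nonempty[of \<A>] by blast
  then have P: "submonoid P G" "x \<in> P" "inv x \<notin> P" by (auto simp: \<A>_def)
  have adjoin: "\<exists>p\<in>P. \<exists>n::nat. inv x = p \<otimes> a [^] n" if a: "a \<in> carrier G" "a \<notin> P" for a
  proof (rule ccontr)
    let ?P = "{p \<otimes> a [^] (n::nat) | p n. p \<in> P}"
    assume *: "\<not> ?thesis"
    have "P \<subseteq> ?P"
    proof
      fix p assume "p \<in> P"
      then have "p = p \<otimes> a [^] (0::nat)" using submonoid.subset[OF P(1)] by auto
      then show "p \<in> ?P" using \<open>p \<in> P\<close> by blast
    qed
    moreover have "a \<in> ?P"
    proof -
      have "a = \<one> \<otimes> a [^] (1::nat)" using a by simp
      then show ?thesis using submonoid.one_closed[OF P(1)] by blast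
    qed
    moreover have "?P \<in> \<A>"
      using * P \<open>P \<subseteq> ?P\<close> submonoid_adjoin[OF P(1) a(1)] unfolding \<A>_def by blast
    ultimately show False using max a by blast
  qed
  have "a \<in> P \<or> inv a \<in> P" if "a \<in> carrier G" for a
    using adjoin[of a] adjoin[of "inv a"] submonoid_avoiding_inverse_adjoin[OF P that] that
    by (metis inv_closed)
  then show thesis using P that by blast
qed

text \<open>
  A submonoid containing each element or its inverse is taken as the set of elements above the
  identity. The element \<open>inv x\<close> outside it lies strictly below the identity.
\<close>

lemma (in comm_group) not_torsion_imp_proper_preorder:
  assumes "torsion G \<noteq> carrier G"
  shows "\<exists>Q. proper_preorder G Q"
proof -
  obtain x where x: "x \<in> carrier G" "x \<notin> torsion G"
    using assms subgroup.subset[OF subgroup_torsion] by blast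
  then obtain P where P: "submonoid P G" "inv x \<notin> P"
    and tot: "\<And>a. a \<in> carrier G \<Longrightarrow> a \<in> P \<or> inv a \<in> P"
    using exists_total_submonoid by blast
  define Q where "Q = {(a, b) \<in> carrier G \<times> carrier G. inv a \<otimes> b \<in> P}"
  have "trans Q"
  proof (rule transI)
    fix a b c assume ab: "(a, b) \<in> Q" and bc: "(b, c) \<in> Q"
    then have c: "a \<in> carrier G" "b \<in> carrier G" "c \<in> carrier G" by (auto simp: Q_def)
    have "(inv a \<otimes> b) \<otimes> (inv b \<otimes> c) \<in> P"
      using submonoid.m_closed[OF P(1)] ab bc unfolding Q_def by blast
    also have "(inv a \<otimes> b) \<otimes> (inv b \<otimes> c) = inv a \<otimes> c"
      using c by (metis inv_closed m_assoc m_closed r_inv l_one)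
    finally show "(a, c) \<in> Q" using c by (simp add: Q_def)
  qed
  moreover have "compatible_rel G Q"
  proof -
    have "inv (z \<otimes> a) \<otimes> (z \<otimes> b) = inv a \<otimes> b"
      if "a \<in> carrier G" "b \<in> carrier G" "z \<in> carrier G" for a b z
      using that by (metis inv_closed inv_mult_group inv_solve_left m_assoc m_closed)
    then show ?thesis unfolding compatible_rel_def Q_def by (auto simp: m_comm)
  qed
  moreover have "(a, b) \<in> Q \<or> (b, a) \<in> Q" if "a \<in> carrier G" "b \<in> carrier G" for a b
    using tot[of "inv a \<otimes> b"] that by (auto simp: Q_def inv_mult_group)
  moreover have "Q \<noteq> carrier G \<times> carrier G"
  proof -
    have "(x, \<one>) \<notin> Q" using x P by (auto simp: Q_def)
    then show ?thesis using x by blast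
  qed
  ultimately have "proper_preorder G Q"
    unfolding proper_preorder_def Q_def by blast
  then show ?thesis by blast
qed

section \<open>The equivalences\<close>

theorem corollary9:
  fixes G (structure)
  assumes "group G"
  shows "((\<exists>r. weak_order_on (carrier G) r \<and> compatible_rel G r \<and> r \<noteq> Id_on (carrier G)) \<longleftrightarrow>
            (\<exists>H. H \<lhd> G \<and> H \<noteq> carrier G \<and> totally_orderable (G Mod H))) \<and>
         (comm_group G \<longrightarrow>
            subgroup (torsion G) G \<and>
            ((\<exists>r. weak_order_on (carrier G) r \<and> compatible_rel G r \<and> r \<noteq> Id_on (carrier G)) \<longleftrightarrow>
               torsion G \<noteq> carrier G) \<and>
            ((\<exists>H. H \<lhd> G \<and> H \<noteq> carrier G \<and> totally_orderable (G Mod H)) \<longleftrightarrow>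
               torsion G \<noteq> carrier G))"
proof -
  interpret group G by (rule assms)
  have weak: "(\<exists>r. weak_order_on (carrier G) r \<and> compatible_rel G r \<and> r \<noteq> Id_on (carrier G)) \<longleftrightarrow>
      (\<exists>Q. proper_preorder G Q)"
    using weak_order_imp_proper_preorder proper_preorder_imp_weak_order by blast
  have quot: "(\<exists>H. H \<lhd> G \<and> H \<noteq> carrier G \<and> totally_orderable (G Mod H)) \<longleftrightarrow>
      (\<exists>Q. proper_preorder G Q)"
    using proper_preorder_imp_orderable_quotient orderable_quotient_imp_proper_preorder by blast
  have tors: "(\<exists>Q. proper_preorder G Q) \<longleftrightarrow> torsion G \<noteq> carrier G" if "comm_group G"
    using proper_preorder_imp_not_torsion comm_group.not_torsion_imp_proper_preorder[OF that]
    by blast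
  show ?thesis
    unfolding weak quot using tors comm_group.subgroup_torsion by blast
qed

end
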